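(* Let $G$ and $H$ be finite non-bipartite vertex-transitive graphs such that $\frac{\alpha(H)}{|V(H)|}=\frac{\alpha(G)}{|V(G)|}$. If $G\times H$ is MIS-normal, then $G$, $H$ and $G\times H$ are all IS-primitive.
   Context: Graphs are finite and simple. The direct product $G\times H$ has vertex set $V(G)\times V(H)$, with $(u_1,u_2)$ adjacent to $(v_1,v_2)$ iff $\{u_1,v_1\}\in E(G)$ and $\{u_2,v_2\}\in E(H)$. $\alpha(\cdot)$ is the independence number. $G\times H$ is MIS-normal if every maximum independent set of $G\times H$ is of the form $I\times V(H)$ with $I$ an independent set of $G$, or $V(G)\times I$ with $I$ an independent set of $H$. For $A\subseteq V(X)$, $N_X[A]$ is $A$ together with all vertices adjacent to some vertex of $A$. For a vertex-transitive graph $X$, an independent set $A$ is imprimitive if $|A|<\alpha(X)$ and $\frac{|A|}{|N_X[A]|}=\frac{\alpha(X)}{|V(X)|}$; $X$ is IS-imprimitive if it has an imprimitive independent set, and IS-primitive otherwise. *)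

theory Defs
  imports Complex_Main "Graph_Theory.Pair_Digraph"
begin

text \<open>
  A finite simple graph is a \<open>pair_graph\<close>: finite vertex set \<open>pverts G\<close>, and edge set encoded by the
  symmetric irreflexive relation \<open>parcs G\<close> on it, an edge \<open>{u, v}\<close> being the two pairs
  \<open>(u, v)\<close> and \<open>(v, u)\<close>. The definitions below are meant for such graphs.
\<close>

definition bipartite :: "'a pair_pre_digraph \<Rightarrow> bool" where
  "bipartite G \<longleftrightarrow>
     (\<exists>X Y. X \<union> Y = pverts G \<and> X \<inter> Y = {} \<and> parcs G \<subseteq> X \<times> Y \<union> Y \<times> X)"

definition automorphism :: "'a pair_pre_digraph \<Rightarrow> ('a \<Rightarrow> 'a) \<Rightarrow> bool" where
  "automorphism G f \<longleftrightarrow>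
     bij_betw f (pverts G) (pverts G) \<and>
     (\<forall>u\<in>pverts G. \<forall>v\<in>pverts G. (f u, f v) \<in> parcs G \<longleftrightarrow> (u, v) \<in> parcs G)"

definition vertex_transitive :: "'a pair_pre_digraph \<Rightarrow> bool" where
  "vertex_transitive G \<longleftrightarrow>
     (\<forall>u\<in>pverts G. \<forall>v\<in>pverts G. \<exists>f. automorphism G f \<and> f u = v)"

definition direct_product ::
  "'a pair_pre_digraph \<Rightarrow> 'b pair_pre_digraph \<Rightarrow> ('a \<times> 'b) pair_pre_digraph" where
  "direct_product G H =
     \<lparr> pverts = pverts G \<times> pverts H,
       parcs = {((u1, u2), (v1, v2)) | u1 u2 v1 v2. (u1, v1) \<in> parcs G \<and> (u2, v2) \<in> parcs H} \<rparr>"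

definition independent_set :: "'a pair_pre_digraph \<Rightarrow> 'a set \<Rightarrow> bool" where
  "independent_set G I \<longleftrightarrow> I \<subseteq> pverts G \<and> (\<forall>u\<in>I. \<forall>v\<in>I. (u, v) \<notin> parcs G)"

definition independence_number :: "'a pair_pre_digraph \<Rightarrow> nat" where
  "independence_number G = Max (card ` {I. independent_set G I})"

definition maximum_independent_set :: "'a pair_pre_digraph \<Rightarrow> 'a set \<Rightarrow> bool" where
  "maximum_independent_set G S \<longleftrightarrow> independent_set G S \<and> card S = independence_number G"

definition MIS_normal :: "'a pair_pre_digraph \<Rightarrow> 'b pair_pre_digraph \<Rightarrow> bool" where
  "MIS_normal G H \<longleftrightarrow>
     (\<forall>S. maximum_independent_set (direct_product G H) S \<longrightarrow>
        (\<exists>I. independent_set G I \<and> S = I \<times> pverts H) \<or>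
        (\<exists>I. independent_set H I \<and> S = pverts G \<times> I))"

definition closed_nbhd :: "'a pair_pre_digraph \<Rightarrow> 'a set \<Rightarrow> 'a set" where
  "closed_nbhd X A = A \<union> {v \<in> pverts X. \<exists>u\<in>A. (u, v) \<in> parcs X}"

text \<open>
  The empty set is never imprimitive: for it the left quotient is \<open>0 / 0 = 0\<close>, whereas the right one
  is positive as soon as the graph has a vertex (and without vertices there is no \<open>A\<close> with
  \<open>card A < independence_number X\<close>).
\<close>

definition imprimitive_independent_set :: "'a pair_pre_digraph \<Rightarrow> 'a set \<Rightarrow> bool" where
  "imprimitive_independent_set X A \<longleftrightarrow>
     independent_set X A \<and> card A < independence_number X \<and>
     real (card A) / real (card (closed_nbhd X A)) =
       real (independence_number X) / real (card (pverts X))"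

definition IS_imprimitive :: "'a pair_pre_digraph \<Rightarrow> bool" where
  "IS_imprimitive X \<longleftrightarrow> (\<exists>A. imprimitive_independent_set X A)"

definition IS_primitive :: "'a pair_pre_digraph \<Rightarrow> bool" where
  "IS_primitive X \<longleftrightarrow> \<not> IS_imprimitive X"

lemma pair_graph_direct_product:
  assumes "pair_graph G" and "pair_graph H"
  shows "pair_graph (direct_product G H)"
proof -
  interpret G: pair_graph G by fact
  interpret H: pair_graph H by fact
  have sG: "(v, u) \<in> parcs G" if "(u, v) \<in> parcs G" for u v
    using G.pair_sym_arcs that by (auto simp: symmetric_def sym_def)
  have sH: "(v, u) \<in> parcs H" if "(u, v) \<in> parcs H" for u v
    using H.pair_sym_arcs that by (auto simp: symmetric_def sym_def)
  have sub: "parcs (direct_product G H) \<subseteq>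
      pverts (direct_product G H) \<times> pverts (direct_product G H)"
    by (auto simp: direct_product_def dest: G.in_arcsD1 G.in_arcsD2 H.in_arcsD1 H.in_arcsD2)
  have fin: "finite (pverts (direct_product G H))"
    using G.pair_finite_verts H.pair_finite_verts by (simp add: direct_product_def)
  show ?thesis
  proof
    show "finite (parcs (direct_product G H))"
      using sub fin by (meson finite_SigmaI finite_subset)
    show "symmetric (with_proj (direct_product G H))"
      by (auto simp: symmetric_def sym_def direct_product_def intro: sG sH)
    show "fst e \<noteq> snd e" if "e \<in> parcs (direct_product G H)" for e
      using that by (auto simp: direct_product_def dest: G.no_loops')
  qed (use sub fin in auto)
qed

lemma vertex_transitive_direct_product:
  assumes "vertex_transitive G" and "vertex_transitive H"
  shows "vertex_transitive (direct_product G H)"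
  unfolding vertex_transitive_def
proof (intro ballI)
  fix u v
  assume uv: "u \<in> pverts (direct_product G H)" "v \<in> pverts (direct_product G H)"
  then obtain f g where f: "automorphism G f" "f (fst u) = fst v"
    and g: "automorphism H g" "g (snd u) = snd v"
    using assms unfolding vertex_transitive_def direct_product_def
    by (metis mem_Times_iff pair_pre_digraph.select_convs(1))
  have "bij_betw (map_prod f g) (pverts G \<times> pverts H) (pverts G \<times> pverts H)"
    using f g by (auto simp: automorphism_def intro: bij_betw_map_prod)
  then have "automorphism (direct_product G H) (map_prod f g)"
    using f g by (auto simp: automorphism_def direct_product_def)
  moreover have "map_prod f g u = v"
    using f g by (simp add: map_prod_def split_def)
  ultimately show "\<exists>h. automorphism (direct_product G H) h \<and> h u = v"
    by blast
qed

end

theory Submission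
  imports Defs "HOL-Combinatorics.Permutations"
begin

text \<open>
  Replacing \<open>S \<inter> N[A]\<close> by \<open>A\<close> in a maximum independent set \<open>S\<close> gives an independent set again, and a
  maximum one if \<open>A\<close> is imprimitive. If \<open>A\<close> is imprimitive in \<open>G\<close> and \<open>J\<close> is a maximum independent
  set of \<open>H\<close>, the exchange of \<open>V(G) \<times> J\<close> along \<open>A \<times> V(H)\<close> has some fibres equal to \<open>J\<close> and others
  equal to \<open>V(H)\<close>, contrary to normality. If \<open>B\<close> is imprimitive in the product, one compares the
  exchanges along \<open>B\<close> of \<open>I \<times> V(H)\<close> and \<open>V(G) \<times> J\<close> for suitable maximum independent sets \<open>I\<close>
  and \<open>J\<close>; in the last case \<open>G\<close> turns out to be bipartite.
\<close>

section \<open>Independent sets in finite and non-bipartite graphs\<close>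

lemma pair_graph_arcs:
  assumes "pair_graph G"
  shows "finite (pverts G)"
    and "(u, v) \<in> parcs G \<Longrightarrow> (v, u) \<in> parcs G"
    and "(u, v) \<in> parcs G \<Longrightarrow> u \<in> pverts G"
    and "(u, v) \<in> parcs G \<Longrightarrow> v \<in> pverts G"
proof -
  interpret pair_graph G by fact
  show "finite (pverts G)" by (rule pair_finite_verts)
  show "(v, u) \<in> parcs G" if "(u, v) \<in> parcs G"
    using pair_sym_arcs that by (auto simp: symmetric_def sym_def)
  show "u \<in> pverts G" "v \<in> pverts G" if "(u, v) \<in> parcs G"
    using that by (auto dest: in_arcsD1 in_arcsD2)
qed

lemma finite_independent_sets: "finite (pverts G) \<Longrightarrow> finite {I. independent_set G I}"
  by (rule finite_subset[of _ "Pow (pverts G)"]) (auto simp: independent_set_def)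

lemma card_independent_set_le:
  "finite (pverts G) \<Longrightarrow> independent_set G I \<Longrightarrow> card I \<le> independence_number G"
  unfolding independence_number_def by (rule Max_ge) (auto intro: finite_independent_sets)

lemma ex_maximum_independent_set:
  assumes "finite (pverts G)"
  obtains S where "maximum_independent_set G S"
proof -
  have "independent_set G {}" by (simp add: independent_set_def)
  then have "Max (card ` {I. independent_set G I}) \<in> card ` {I. independent_set G I}"
    using assms by (intro Max_in) (auto intro: finite_independent_sets)
  then show ?thesis
    using that by (auto simp: maximum_independent_set_def independence_number_def)
qed

lemma maximum_independent_setD:
  assumes "maximum_independent_set G S"
  shows "independent_set G S" "card S = independence_number G" "S \<subseteq> pverts G"
  using assms by (auto simp: maximum_independent_set_def independent_set_def)

lemma nonbipartite_ex_arc: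
  assumes "\<not> bipartite G"
  obtains u v where "(u, v) \<in> parcs G"
proof -
  \<comment> \<open>A graph without arcs is bipartite with one side empty.\<close>
  have "parcs G \<noteq> {}"
    using assms unfolding bipartite_def by (metis Int_empty_right Un_empty_right empty_subsetI)
  then show ?thesis using that by auto
qed

text \<open>An arc exists, and its two ends cannot both lie in \<open>I\<close>. Applied to the
  empty set, this also gives that \<open>pverts G\<close> is nonempty.\<close>

lemma independent_set_psubset:
  assumes "pair_graph G" "\<not> bipartite G" "independent_set G I"
  shows "I \<subset> pverts G"
proof -
  obtain u v where uv: "(u, v) \<in> parcs G" using nonbipartite_ex_arc[OF assms(2)] .
  then show ?thesis
    using assms(3) pair_graph_arcs(3,4)[OF assms(1) uv] by (auto simp: independent_set_def)
qed

lemma independence_number_pos: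
  assumes "pair_graph G" "\<not> bipartite G"
  shows "0 < independence_number G"
proof -
  obtain u v where uv: "(u, v) \<in> parcs G" using nonbipartite_ex_arc[OF assms(2)] .
  interpret pair_graph G by fact
  note G = pair_graph_arcs[OF assms(1)]
  have "independent_set G {u}"
    using G(3)[OF uv] no_loops'[of u u] by (auto simp: independent_set_def)
  then have "card {u} \<le> independence_number G"
    by (rule card_independent_set_le[OF G(1)])
  then show ?thesis by simp
qed

lemma maximum_independent_set_nontrivial:
  assumes "pair_graph G" "\<not> bipartite G" "maximum_independent_set G S"
  shows "S \<noteq> {}" "S \<noteq> pverts G"
proof -
  show "S \<noteq> {}"
    using independence_number_pos[OF assms(1,2)] maximum_independent_setD(2)[OF assms(3)]
    by (metis card.empty less_irrefl)
  show "S \<noteq> pverts G"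
    using independent_set_psubset[OF assms(1,2) maximum_independent_setD(1)[OF assms(3)]] by blast
qed

section \<open>Images of independent sets and neighbourhoods under automorphisms\<close>

lemma independent_set_image:
  assumes "automorphism G f" "independent_set G I"
  shows "independent_set G (f ` I)"
proof -
  have "I \<subseteq> pverts G" "f ` pverts G = pverts G"
    using assms by (auto simp: automorphism_def independent_set_def bij_betw_def)
  then show ?thesis
    using assms unfolding automorphism_def independent_set_def
    by (simp add: subset_iff) blast
qed

lemma card_image_automorphism:
  assumes "automorphism G f" "I \<subseteq> pverts G"
  shows "card (f ` I) = card I"
  using assms unfolding automorphism_def bij_betw_def
  by (meson card_image inj_on_subset)

lemma maximum_independent_set_image:
  assumes "automorphism G f" "maximum_independent_set G S"
  shows "maximum_independent_set G (f ` S)"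
  using independent_set_image[OF assms(1) maximum_independent_setD(1)[OF assms(2)]]
    card_image_automorphism[OF assms(1) maximum_independent_setD(3)[OF assms(2)]]
    maximum_independent_setD(2)[OF assms(2)]
  by (simp add: maximum_independent_set_def)

lemma closed_nbhd_subset: "A \<subseteq> pverts G \<Longrightarrow> closed_nbhd G A \<subseteq> pverts G"
  by (auto simp: closed_nbhd_def)

lemma closed_nbhd_image:
  assumes f: "automorphism G f" and A: "A \<subseteq> pverts G"
  shows "closed_nbhd G (f ` A) = f ` closed_nbhd G A"
proof
  have im: "f ` pverts G = pverts G"
    and arc: "\<And>u v. u \<in> pverts G \<Longrightarrow> v \<in> pverts G \<Longrightarrow> (f u, f v) \<in> parcs G \<longleftrightarrow> (u, v) \<in> parcs G"
    using f by (auto simp: automorphism_def bij_betw_def)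
  show "closed_nbhd G (f ` A) \<subseteq> f ` closed_nbhd G A"
  proof
    fix w assume w: "w \<in> closed_nbhd G (f ` A)"
    show "w \<in> f ` closed_nbhd G A"
    proof (cases "w \<in> f ` A")
      case False
      then obtain a where a: "a \<in> A" "(f a, w) \<in> parcs G" "w \<in> pverts G"
        using w by (auto simp: closed_nbhd_def)
      then obtain v where "v \<in> pverts G" "w = f v" using im by blast
      then have "v \<in> closed_nbhd G A" using a A arc by (auto simp: closed_nbhd_def)
      then show ?thesis using \<open>w = f v\<close> by blast
    qed (auto simp: closed_nbhd_def)
  qed
  show "f ` closed_nbhd G A \<subseteq> closed_nbhd G (f ` A)"
    using A arc im by (auto simp: closed_nbhd_def)
qed

section \<open>Exchanging part of an independent set along \<open>A\<close>\<close>

text \<open>A vertex outside N[A] has no neighbour in \<open>A\<close>, so the two pieces, each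
  independent, have no arcs between them.\<close>

lemma exchange_independent_set:
  assumes "pair_graph G" "independent_set G S" "independent_set G A"
  shows "independent_set G (S - closed_nbhd G A \<union> A)"
proof -
  have "(u, v) \<notin> parcs G" "(v, u) \<notin> parcs G" if "u \<in> S - closed_nbhd G A" "v \<in> A" for u v
    using that assms(2) pair_graph_arcs(2)[OF assms(1)]
    by (auto simp: closed_nbhd_def independent_set_def)
  then show ?thesis
    using assms(2,3) by (auto simp: independent_set_def)
qed

lemma card_exchange:
  assumes "finite S" "finite A"
  shows "card (S - closed_nbhd G A \<union> A) + card (S \<inter> closed_nbhd G A) = card S + card A"
proof -
  have "card (S - closed_nbhd G A \<union> A) = card (S - closed_nbhd G A) + card A"
    using assms by (intro card_Un_disjoint) (auto simp: closed_nbhd_def)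
  moreover have "card S = card (S - closed_nbhd G A) + card (S \<inter> closed_nbhd G A)"
    using assms card_Diff_subset_Int[of S "closed_nbhd G A"]
    by (simp add: card_mono)
  ultimately show ?thesis by simp
qed

text \<open>The exchanged set is independent, hence no larger than \<open>S\<close>; so at least as
  many vertices were removed as the \<open>card A\<close> that were added.\<close>

lemma card_le_card_Int_closed_nbhd:
  assumes "pair_graph G" "maximum_independent_set G S" "independent_set G A"
  shows "card A \<le> card (S \<inter> closed_nbhd G A)"
proof -
  note fin = pair_graph_arcs(1)[OF assms(1)]
  have "finite S" "finite A"
    using fin assms(2,3) by (auto simp: maximum_independent_set_def independent_set_def intro: finite_subset)
  then show ?thesis
    using card_exchange[of S A G] maximum_independent_setD[OF assms(2)]
      card_independent_set_le[OF fin exchange_independent_set[OF assms(1) _ assms(3)]]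
    by fastforce
qed

section \<open>The finite automorphism group and averaging over it\<close>

text \<open>\<open>automorphism\<close> leaves the values outside \<open>pverts G\<close> arbitrary.
  Fixing every point there gives each automorphism a single representative, so that the group is
  finite and sums over it make sense.\<close>

definition automorphism_perms :: "'a pair_pre_digraph \<Rightarrow> ('a \<Rightarrow> 'a) set" where
  "automorphism_perms G = {f. f permutes pverts G \<and> automorphism G f}"

lemma finite_automorphism_perms:
  "finite (pverts G) \<Longrightarrow> finite (automorphism_perms G)"
  unfolding automorphism_perms_def by (rule finite_subset[OF _ finite_permutations]) auto

lemma id_in_automorphism_perms: "id \<in> automorphism_perms G"
  by (auto simp: automorphism_perms_def automorphism_def permutes_id)

lemma comp_in_automorphism_perms:
  assumes "f \<in> automorphism_perms G" "g \<in> automorphism_perms G"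
  shows "g \<circ> f \<in> automorphism_perms G"
proof -
  have "f permutes pverts G" "g permutes pverts G"
    using assms by (auto simp: automorphism_perms_def)
  then have "g \<circ> f permutes pverts G" by (rule permutes_compose)
  then show ?thesis
    using assms \<open>f permutes pverts G\<close> permutes_imp_bij[of "g \<circ> f" "pverts G"] 
    by (auto simp: automorphism_perms_def automorphism_def permutes_in_image)
qed

lemma vertex_transitive_perm:
  assumes "vertex_transitive G" "u \<in> pverts G" "v \<in> pverts G"
  obtains f where "f \<in> automorphism_perms G" "f u = v"
proof -
  obtain f where f: "automorphism G f" "f u = v"
    using assms unfolding vertex_transitive_def by blast
  \<comment> \<open>The normalised representative: \<open>f\<close> on the vertices, the identity
    elsewhere.\<close>
  define g where "g x = (if x \<in> pverts G then f x else x)" for x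
  have "bij_betw g (pverts G) (pverts G)"
    using f by (simp add: automorphism_def g_def cong: bij_betw_cong)
  then have "g permutes pverts G"
    by (rule bij_imp_permutes) (simp add: g_def)
  then have "g \<in> automorphism_perms G"
    using f \<open>bij_betw g _ _\<close> by (auto simp: automorphism_perms_def automorphism_def g_def)
  then show ?thesis using that f assms by (auto simp: g_def)
qed

text \<open>Orbit counting: composing with some \<open>g\<close> that takes \<open>w\<close> to
  \<open>w'\<close> injects the fibre over \<open>w\<close> into the fibre over \<open>w'\<close>.
  By symmetry all fibres have the same size, and they partition the group.\<close>

lemma card_automorphism_perms_fibre:
  assumes fin: "finite (pverts G)" and vt: "vertex_transitive G"
    and u: "u \<in> pverts G" and v: "v \<in> pverts G"
  shows "card (pverts G) * card {f \<in> automorphism_perms G. f u = v} = card (automorphism_perms G)"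
proof -
  let ?F = "\<lambda>w. {f \<in> automorphism_perms G. f u = w}"
  have finF: "finite (?F w)" for w
    by (rule finite_subset[OF _ finite_automorphism_perms[OF fin]]) auto
  have le: "card (?F w) \<le> card (?F w')" if w: "w \<in> pverts G" "w' \<in> pverts G" for w w'
  proof -
    obtain g where g: "g \<in> automorphism_perms G" "g w = w'"
      using vertex_transitive_perm[OF vt w] .
    then have "inj g" by (auto simp: automorphism_perms_def permutes_inj)
    show ?thesis
    proof (rule card_inj_on_le)
      show "inj_on ((\<circ>) g) (?F w)"
        using fun.inj_map[OF \<open>inj g\<close>] by (rule inj_on_subset) simp
      show "(\<circ>) g ` ?F w \<subseteq> ?F w'"
        using g comp_in_automorphism_perms by auto
    qed (rule finF)
  qed
  have "automorphism_perms G = (\<Union>w\<in>pverts G. ?F w)"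
    using u by (auto simp: automorphism_perms_def permutes_in_image)
  then have "card (automorphism_perms G) = (\<Sum>w\<in>pverts G. card (?F w))"
    using card_UN_disjoint[of "pverts G" ?F] fin finF by auto
  also have "\<dots> = (\<Sum>w\<in>pverts G. card (?F v))"
    using le v by (intro sum.cong refl antisym) auto
  finally show ?thesis by simp
qed

text \<open>Double counting of the triples \<open>(f, u, v)\<close> with \<open>u\<close> in
  \<open>C\<close>, \<open>v\<close> in \<open>S\<close> and \<open>f u = v\<close>: each pair
  \<open>(u, v)\<close> is hit by the same number of automorphisms. It says that a random translate
  of \<open>C\<close> meets \<open>S\<close> in |C| |S| / |V| points on average.\<close>

lemma sum_card_image_Int:
  assumes fin: "finite (pverts G)" and vt: "vertex_transitive G"
    and C: "C \<subseteq> pverts G" and S: "S \<subseteq> pverts G"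
  shows "card (pverts G) * (\<Sum>f\<in>automorphism_perms G. card (S \<inter> f ` C)) =
         card (automorphism_perms G) * card C * card S"
proof -
  let ?\<Gamma> = "automorphism_perms G"
  note finA = finite_automorphism_perms[OF fin]
  have fC: "finite C" "finite S" using C S fin by (auto intro: finite_subset)
  have "card (S \<inter> f ` C) = (\<Sum>u\<in>C. \<Sum>v\<in>S. if f u = v then 1 else 0)" if "f \<in> ?\<Gamma>" for f
  proof -
    have "inj f" using that by (auto simp: automorphism_perms_def permutes_inj)
    have "S \<inter> f ` C = f ` {u \<in> C. f u \<in> S}" by auto
    then have "card (S \<inter> f ` C) = card {u \<in> C. f u \<in> S}"
      using \<open>inj f\<close> by (simp add: card_image inj_on_def)
    then show ?thesis
      using fC by (simp add: sum.If_cases Int_def)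
  qed
  then have "(\<Sum>f\<in>?\<Gamma>. card (S \<inter> f ` C)) = (\<Sum>f\<in>?\<Gamma>. \<Sum>u\<in>C. \<Sum>v\<in>S. if f u = v then 1 else 0)"
    by simp
  also have "\<dots> = (\<Sum>u\<in>C. \<Sum>f\<in>?\<Gamma>. \<Sum>v\<in>S. if f u = v then 1 else 0)"
    by (rule sum.swap)
  also have "\<dots> = (\<Sum>u\<in>C. \<Sum>v\<in>S. \<Sum>f\<in>?\<Gamma>. if f u = v then 1 else 0)"
    by (intro sum.cong refl sum.swap)
  also have "\<dots> = (\<Sum>u\<in>C. \<Sum>v\<in>S. card {f \<in> ?\<Gamma>. f u = v})"
    using finA by (simp add: sum.If_cases Int_def)
  finally have "card (pverts G) * (\<Sum>f\<in>?\<Gamma>. card (S \<inter> f ` C)) =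
      (\<Sum>u\<in>C. \<Sum>v\<in>S. card (pverts G) * card {f \<in> ?\<Gamma>. f u = v})"
    by (simp add: sum_distrib_left)
  also have "\<dots> = (\<Sum>u\<in>C. \<Sum>v\<in>S. card ?\<Gamma>)"
    using C S by (intro sum.cong refl card_automorphism_perms_fibre[OF fin vt]) auto
  finally show ?thesis by simp
qed

section \<open>Imprimitive independent sets and their exchanges\<close>

lemma imprimitive_independent_setD:
  assumes "pair_graph G" "0 < independence_number G" "imprimitive_independent_set G A"
  shows "independent_set G A"
    and "card A * card (pverts G) = independence_number G * card (closed_nbhd G A)"
    and "A \<noteq> {}"
    and "closed_nbhd G A \<subset> pverts G"
proof -
  note fin = pair_graph_arcs(1)[OF assms(1)]
  show ind: "independent_set G A"
    using assms(3) by (simp add: imprimitive_independent_set_def)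
  then have sub: "A \<subseteq> pverts G" by (simp add: independent_set_def)
  obtain S where S: "maximum_independent_set G S"
    using ex_maximum_independent_set[OF fin] .
  have pos: "0 < independence_number G" "0 < card (pverts G)"
  proof -
    have "S \<noteq> {}" using assms(2) maximum_independent_setD(2)[OF S] by force
    then have "pverts G \<noteq> {}" using maximum_independent_setD(3)[OF S] by blast
    then show "0 < card (pverts G)" using fin by (simp add: card_gt_0_iff)
  qed (rule assms(2))
  have lt: "card A < independence_number G"
    and eq: "real (card A) / real (card (closed_nbhd G A)) =
      real (independence_number G) / real (card (pverts G))"
    using assms(3) by (auto simp: imprimitive_independent_set_def)
  \<comment> \<open>An empty neighbourhood would make the left quotient 0, by the convention on
    division by 0, whereas the right one is positive.\<close>
  have ne: "card (closed_nbhd G A) \<noteq> 0"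
  proof
    assume "card (closed_nbhd G A) = 0"
    then show False using eq pos by simp
  qed
  have "real (card A * card (pverts G)) = real (independence_number G * card (closed_nbhd G A))"
    using eq pos ne by (simp add: field_simps)
  then show prod: "card A * card (pverts G) = independence_number G * card (closed_nbhd G A)"
    by linarith
  show "A \<noteq> {}" using eq pos by auto
  \<comment> \<open>If N[A] were all of V, the product equation would force \<open>card A\<close> to
    be the independence number.\<close>
  have "closed_nbhd G A \<noteq> pverts G" using prod lt pos by auto
  then show "closed_nbhd G A \<subset> pverts G" using closed_nbhd_subset[OF sub] by auto
qed

text \<open>
  For every automorphism \<open>f\<close> the set \<open>S\<close> meets \<open>f ` N[A]\<close> in at least \<open>|A|\<close> points, while
  the average over all \<open>f\<close> is \<open>|S| |N[A]| / |V| = |A|\<close>; so there is equality for all \<open>f\<close>,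
  in particular for the identity.
\<close>

lemma maximum_exchange_imprimitive:
  assumes G: "pair_graph G" "0 < independence_number G" and vt: "vertex_transitive G"
    and A: "imprimitive_independent_set G A" and S: "maximum_independent_set G S"
  shows "maximum_independent_set G (S - closed_nbhd G A \<union> A)"
proof -
  let ?\<Gamma> = "automorphism_perms G" and ?N = "closed_nbhd G A"
  note fin = pair_graph_arcs(1)[OF G(1)]
  note AD = imprimitive_independent_setD[OF G A]
  note SD = maximum_independent_setD[OF S]
  have A_sub: "A \<subseteq> pverts G" using AD(1) by (simp add: independent_set_def)
  have N_sub: "?N \<subseteq> pverts G" using AD(4) by auto
  have ge: "card A \<le> card (S \<inter> f ` ?N)" if "f \<in> ?\<Gamma>" for f
  proof -
    have f: "automorphism G f" using that by (simp add: automorphism_perms_def)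
    show ?thesis
      using card_le_card_Int_closed_nbhd[OF G(1) S independent_set_image[OF f AD(1)]]
      by (simp add: closed_nbhd_image[OF f A_sub] card_image_automorphism[OF f A_sub])
  qed
  have "card (pverts G) * (\<Sum>f\<in>?\<Gamma>. card (S \<inter> f ` ?N)) = card ?\<Gamma> * card ?N * card S"
    by (rule sum_card_image_Int[OF fin vt N_sub SD(3)])
  also have "\<dots> = card (pverts G) * (\<Sum>f\<in>?\<Gamma>. card A)"
    using AD(2) SD(2) by (simp add: ac_simps)
  finally have sum_eq: "(\<Sum>f\<in>?\<Gamma>. card A) = (\<Sum>f\<in>?\<Gamma>. card (S \<inter> f ` ?N))"
    using AD(4) fin by auto
  have "card A = card (S \<inter> id ` ?N)"
    using sum_mono_inv[OF sum_eq ge id_in_automorphism_perms finite_automorphism_perms[OF fin]] .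
  moreover have "finite S" "finite A"
    using SD(3) A_sub fin by (auto intro: finite_subset)
  ultimately have "card (S - ?N \<union> A) = independence_number G"
    using card_exchange[of S A G] SD(2) by simp
  then show ?thesis
    using exchange_independent_set[OF G(1) SD(1) AD(1)] by (simp add: maximum_independent_set_def)
qed

section \<open>Independent sets of direct products and the symmetry of the factors\<close>

lemma pverts_direct_product [simp]: "pverts (direct_product G H) = pverts G \<times> pverts H"
  by (simp add: direct_product_def)

lemma parcs_direct_product [simp]:
  "((u1, u2), (v1, v2)) \<in> parcs (direct_product G H) \<longleftrightarrow>
     (u1, v1) \<in> parcs G \<and> (u2, v2) \<in> parcs H"
  by (simp add: direct_product_def)

lemma independent_set_Times:
  "independent_set G I \<Longrightarrow> independent_set (direct_product G H) (I \<times> pverts H)"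
  "independent_set H J \<Longrightarrow> independent_set (direct_product G H) (pverts G \<times> J)"
  by (auto simp: independent_set_def)

lemma parcs_direct_product_swap [simp]:
  "(prod.swap p, prod.swap q) \<in> parcs (direct_product G H) \<longleftrightarrow> (p, q) \<in> parcs (direct_product H G)"
  by (cases p, cases q) auto

lemma independent_set_swap:
  assumes "independent_set (direct_product G H) S"
  shows "independent_set (direct_product H G) (prod.swap ` S)"
proof -
  have "prod.swap ` S \<subseteq> prod.swap ` (pverts G \<times> pverts H)"
    using assms by (intro image_mono) (simp add: independent_set_def)
  then show ?thesis
    using assms by (simp add: independent_set_def product_swap)
qed

lemma independence_number_direct_product_le:
  assumes "finite (pverts G)" "finite (pverts H)"
  shows "independence_number (direct_product G H) \<le> independence_number (direct_product H G)"
proof -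
  have fin: "finite (pverts (direct_product G H))" "finite (pverts (direct_product H G))"
    using assms by auto
  obtain S where S: "maximum_independent_set (direct_product G H) S"
    using ex_maximum_independent_set[OF fin(1)] .
  have "card (prod.swap ` S) \<le> independence_number (direct_product H G)"
    by (intro card_independent_set_le fin independent_set_swap maximum_independent_setD(1)[OF S])
  then show ?thesis
    using maximum_independent_setD(2)[OF S] by (simp add: card_image)
qed

lemma independence_number_direct_product_commute:
  assumes "finite (pverts G)" "finite (pverts H)"
  shows "independence_number (direct_product G H) = independence_number (direct_product H G)"
  using assms by (intro antisym independence_number_direct_product_le)

text \<open>Swapping coordinates preserves independence and size and interchanges the two product
  shapes. This lets the result about the left factor be applied to the right one.\<close>

lemma MIS_normal_commute:
  assumes "finite (pverts G)" "finite (pverts H)" "MIS_normal G H"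
  shows "MIS_normal H G"
  unfolding MIS_normal_def
proof (intro allI impI)
  fix S assume S: "maximum_independent_set (direct_product H G) S"
  have "maximum_independent_set (direct_product G H) (prod.swap ` S)"
    using S independent_set_swap[of H G S] independence_number_direct_product_commute[OF assms(1,2)]
    by (simp add: maximum_independent_set_def card_image)
  then consider I where "independent_set G I" "prod.swap ` S = I \<times> pverts H"
    | I where "independent_set H I" "prod.swap ` S = pverts G \<times> I"
    using assms(3) unfolding MIS_normal_def by blast
  moreover have "S = prod.swap ` prod.swap ` S" by (simp add: image_image)
  ultimately show "(\<exists>I. independent_set H I \<and> S = I \<times> pverts G) \<or>
      (\<exists>I. independent_set G I \<and> S = pverts H \<times> I)"
    by cases (metis product_swap)+
qed

text \<open>Some maximum set has one of the two product shapes, and the equal ratios give both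
  shapes the same upper bound; a maximum \<open>I\<close> in \<open>G\<close> yields the converse
  inequality.\<close>

lemma MIS_normal_independence_number:
  assumes G: "finite (pverts G)" and H: "finite (pverts H)" and "MIS_normal G H"
    and ratio: "independence_number H * card (pverts G) = independence_number G * card (pverts H)"
  shows "independence_number (direct_product G H) = independence_number G * card (pverts H)"
proof (rule antisym)
  have fin: "finite (pverts (direct_product G H))"
    using G H by simp
  obtain S where S: "maximum_independent_set (direct_product G H) S"
    using ex_maximum_independent_set[OF fin] .
  consider I where "independent_set G I" "S = I \<times> pverts H"
    | I where "independent_set H I" "S = pverts G \<times> I"
    using assms(3) S unfolding MIS_normal_def by blast
  then show "independence_number (direct_product G H) \<le> independence_number G * card (pverts H)"
  proof cases
    case 1
    then show ?thesis
      using maximum_independent_setD(2)[OF S] card_independent_set_le[OF G 1(1)]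
      by (metis card_cartesian_product mult_le_mono1)
  next
    case 2
    then show ?thesis
      using maximum_independent_setD(2)[OF S] card_independent_set_le[OF H 2(1)] ratio
      by (metis card_cartesian_product mult.commute mult_le_mono1)
  qed
next
  obtain I where I: "maximum_independent_set G I"
    using ex_maximum_independent_set[OF G] .
  have "card (I \<times> pverts H) \<le> independence_number (direct_product G H)"
    using G H by (intro card_independent_set_le independent_set_Times maximum_independent_setD(1)[OF I]) auto
  then show "independence_number G * card (pverts H) \<le> independence_number (direct_product G H)"
    using maximum_independent_setD(2)[OF I] by (simp add: card_cartesian_product)
qed

section \<open>Primitivity of a factor\<close>

lemma MIS_normal_imp_left_IS_primitive:
  assumes G: "pair_graph G" "\<not> bipartite G" and H: "pair_graph H" "\<not> bipartite H"
    and ratio: "independence_number H * card (pverts G) = independence_number G * card (pverts H)"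
    and normal: "MIS_normal G H"
  shows "IS_primitive G"
  unfolding IS_primitive_def IS_imprimitive_def
proof
  assume "\<exists>A. imprimitive_independent_set G A"
  then obtain A where A: "imprimitive_independent_set G A" ..
  note AD = imprimitive_independent_setD[OF G(1) independence_number_pos[OF G] A]
  note finG = pair_graph_arcs(1)[OF G(1)] and finH = pair_graph_arcs(1)[OF H(1)]
  note alpha = MIS_normal_independence_number[OF finG finH normal ratio]
  obtain J where J: "maximum_independent_set H J"
    using ex_maximum_independent_set[OF finH] .
  note JD = maximum_independent_setD[OF J] maximum_independent_set_nontrivial[OF H J]
  let ?R = "pverts G - closed_nbhd G A"
  \<comment> \<open>The fibre is \<open>J\<close> over the vertices outside N[A], all of V(H) over
    \<open>A\<close>, and empty over the rest of N[A].\<close>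
  let ?S = "?R \<times> J \<union> A \<times> pverts H"
  have A_sub: "A \<subseteq> pverts G" using AD(1) by (simp add: independent_set_def)
  have "independent_set (direct_product G H) ?S"
  proof -
    have "(u, u') \<notin> parcs G" if "u \<in> A" "u' \<in> A" for u u'
      using that AD(1) by (simp add: independent_set_def)
    moreover have "(u, r) \<notin> parcs G" "(r, u) \<notin> parcs G" if "u \<in> A" "r \<in> ?R" for u r
      using that pair_graph_arcs(2)[OF G(1)] unfolding closed_nbhd_def by blast+
    moreover have "(v, v') \<notin> parcs H" if "v \<in> J" "v' \<in> J" for v v'
      using that JD(1) by (simp add: independent_set_def)
    ultimately show ?thesis
      using A_sub JD(3) unfolding independent_set_def by auto
  qed
  moreover have "card ?S = independence_number (direct_product G H)"
  proof -
    have finN: "finite (closed_nbhd G A)" using AD(4) finG by (auto intro: finite_subset)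
    have cR: "card ?R + card (closed_nbhd G A) = card (pverts G)"
      using AD(4) finG finN by (simp add: card_Diff_subset card_mono psubset_imp_subset)
    have "card ?S = card ?R * card J + card A * card (pverts H)"
      using A_sub JD(3) finG finH
      by (subst card_Un_disjoint)
        (auto simp: card_cartesian_product closed_nbhd_def dest: finite_subset)
    \<comment> \<open>The vertices over \<open>A\<close> are exactly as many as those of N[A]
      \<times> J. Multiplying by |V(G)| lets the imprimitivity equation and \<open>ratio\<close>
      apply; the factor is then cancelled.\<close>
    moreover have "card (pverts G) * (card A * card (pverts H)) =
        card (pverts G) * (card (closed_nbhd G A) * card J)"
      using AD(2) JD(2) ratio by (metis mult.assoc mult.commute)
    then have "card A * card (pverts H) = card (closed_nbhd G A) * card J"
      using AD(4) finG by auto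
    ultimately have "card ?S = (card ?R + card (closed_nbhd G A)) * card J"
      by (simp add: algebra_simps)
    then show ?thesis
      unfolding cR alpha JD(2) using ratio by (simp add: mult.commute)
  qed
  ultimately have max: "maximum_independent_set (direct_product G H) ?S"
    by (simp add: maximum_independent_set_def)
  obtain a r where "a \<in> A" "r \<in> ?R" using AD(3,4) by blast
  then have ar: "a \<in> A" "a \<in> pverts G" "a \<notin> ?R" "r \<in> ?R" "r \<in> pverts G" "r \<notin> A"
    using A_sub by (auto simp: closed_nbhd_def)
  obtain y z where yz: "y \<in> J" "y \<in> pverts H" "z \<in> pverts H" "z \<notin> J" using JD(3,4,5) by blast
  \<comment> \<open>The first two facts say that the fibre over \<open>r\<close> is neither empty
    nor full, which excludes I \<times> V(H); the last two say that the fibres over \<open>r\<close>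
    and \<open>a\<close> differ, which excludes V(G) \<times> I.\<close>
  have "(r, y) \<in> ?S" "(r, z) \<notin> ?S" "(a, z) \<in> ?S"
    using ar yz by auto
  consider I where "?S = I \<times> pverts H" | I where "?S = pverts G \<times> I"
    using normal[unfolded MIS_normal_def, rule_format, OF max] by metis
  then show False
  proof cases
    case 1
    then show False using \<open>(r, y) \<in> ?S\<close> \<open>(r, z) \<notin> ?S\<close> yz(3) by (metis mem_Sigma_iff)
  next
    case 2
    then show False using \<open>(a, z) \<in> ?S\<close> \<open>(r, z) \<notin> ?S\<close> ar(5) by (metis mem_Sigma_iff)
  qed
qed

section \<open>Primitivity of the product\<close>

text \<open>A maximum independent set has vertices both inside and outside it, and transitivity
  moves one of the wanted kind to \<open>u\<close>. The free proposition \<open>P\<close> allows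
  membership to be prescribed by a condition on another set.\<close>

lemma vertex_transitive_maximum_independent_set:
  assumes G: "pair_graph G" "\<not> bipartite G" "vertex_transitive G" and u: "u \<in> pverts G"
  obtains I where "maximum_independent_set G I" "u \<in> I \<longleftrightarrow> P"
proof -
  obtain S where S: "maximum_independent_set G S"
    using ex_maximum_independent_set[OF pair_graph_arcs(1)[OF G(1)]] .
  note SD = maximum_independent_setD[OF S] maximum_independent_set_nontrivial[OF G(1,2) S]
  have "\<exists>w\<in>pverts G. w \<in> S \<longleftrightarrow> P"
    using SD(3-5) by blast
  then obtain w where w: "w \<in> pverts G" "w \<in> S \<longleftrightarrow> P" ..
  obtain f where f: "f \<in> automorphism_perms G" "f w = u"
    using vertex_transitive_perm[OF G(3) w(1) u] .
  then have "automorphism G f" "inj f"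
    by (auto simp: automorphism_perms_def permutes_inj)
  then have "maximum_independent_set G (f ` S)" "u \<in> f ` S \<longleftrightarrow> P"
    using maximum_independent_set_image[OF _ S] w inj_image_mem_iff[OF \<open>inj f\<close>, of w S] f(2) by simp_all
  then show ?thesis by (rule that)
qed

text \<open>
  Let \<open>(a, b) \<in> B\<close> with \<open>B\<close> imprimitive and \<open>(x, y) \<notin> N[B]\<close>. Choosing \<open>b \<notin> J\<close> and then \<open>I\<close> with
  \<open>x \<in> I \<longleftrightarrow> y \<notin> J\<close> makes the exchanges of \<open>I \<times> V(H)\<close> and \<open>V(G) \<times> J\<close> along \<open>B\<close> differ at
  \<open>(x, y)\<close>, although they agree on \<open>N[B]\<close>.
\<close>

lemma MIS_normal_imp_product_IS_primitive:
  assumes G: "pair_graph G" "\<not> bipartite G" "vertex_transitive G"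
    and H: "pair_graph H" "\<not> bipartite H" "vertex_transitive H"
    and ratio: "independence_number H * card (pverts G) = independence_number G * card (pverts H)"
    and normal: "MIS_normal G H"
  shows "IS_primitive (direct_product G H)"
  unfolding IS_primitive_def IS_imprimitive_def
proof
  let ?X = "direct_product G H" and ?V = "pverts G" and ?W = "pverts H"
  assume "\<exists>B. imprimitive_independent_set ?X B"
  then obtain B where B: "imprimitive_independent_set ?X B" ..
  note finG = pair_graph_arcs(1)[OF G(1)] and finH = pair_graph_arcs(1)[OF H(1)]
  note alpha = MIS_normal_independence_number[OF finG finH normal ratio]
  have X: "pair_graph ?X" "vertex_transitive ?X"
    using pair_graph_direct_product vertex_transitive_direct_product G H by blast+
  have X2: "0 < independence_number ?X"
    using alpha independence_number_pos[OF G(1,2)] independent_set_psubset[OF H(1,2)] finH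
    by (fastforce simp: card_gt_0_iff independent_set_def)
  note BD = imprimitive_independent_setD[OF X(1) X2 B]
  define N where "N = closed_nbhd ?X B"
  have B_N: "B \<subseteq> N" by (auto simp: N_def closed_nbhd_def)
  obtain a b where ab: "(a, b) \<in> B" using BD(3) by auto
  obtain x y where xy: "x \<in> ?V" "y \<in> ?W" "(x, y) \<notin> N" using BD(4) by (auto simp: N_def)
  have "b \<in> ?W" using ab BD(1) by (auto simp: independent_set_def)
  \<comment> \<open>That \<open>J\<close> misses \<open>b\<close> is what refutes the case
    \<open>GH\<close> below.\<close>
  obtain J where J: "maximum_independent_set H J" "b \<in> J \<longleftrightarrow> False"
    using vertex_transitive_maximum_independent_set[OF H \<open>b \<in> ?W\<close>] .
  obtain I where I: "maximum_independent_set G I" "x \<in> I \<longleftrightarrow> y \<notin> J"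
    using vertex_transitive_maximum_independent_set[OF G \<open>x \<in> ?V\<close>] .
  note ID = maximum_independent_setD[OF I(1)] maximum_independent_set_nontrivial[OF G(1,2) I(1)]
  note JD = maximum_independent_setD[OF J(1)] maximum_independent_set_nontrivial[OF H(1,2) J(1)]
  define S1 where "S1 = I \<times> ?W - N \<union> B"
  define S2 where "S2 = ?V \<times> J - N \<union> B"
  have "maximum_independent_set ?X (I \<times> ?W)" "maximum_independent_set ?X (?V \<times> J)"
    using independent_set_Times ID(1,2) JD(1,2) alpha ratio
    by (auto simp: maximum_independent_set_def card_cartesian_product mult.commute)
  then have max12: "maximum_independent_set ?X S1" "maximum_independent_set ?X S2"
    unfolding S1_def S2_def N_def
    using maximum_exchange_imprimitive[OF X(1) X2 X(2) B] by auto
  have out: "(u, v) \<in> S1 \<longleftrightarrow> u \<in> I" "(u, v) \<in> S2 \<longleftrightarrow> v \<in> J"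
    if "u \<in> ?V" "v \<in> ?W" "(u, v) \<notin> N" for u v
    using that B_N by (auto simp: S1_def S2_def)
  have inn: "(u, v) \<in> S1 \<longleftrightarrow> (u, v) \<in> B" "(u, v) \<in> S2 \<longleftrightarrow> (u, v) \<in> B" if "(u, v) \<in> N" for u v
    using that by (auto simp: S1_def S2_def)
  have diff: "\<not> ((x, y) \<in> S1 \<longleftrightarrow> (x, y) \<in> S2)"
    using out[OF xy] I(2) by simp
  obtain j j' where j: "j \<in> ?W" "j \<in> J" "j' \<in> ?W" "j' \<notin> J" using JD(3-5) by blast
  obtain i i' where i: "i \<in> ?V" "i \<in> I" "i' \<in> ?V" "i' \<notin> I" using ID(3-5) by blast
  \<comment> \<open>The two letters name the factor whose coordinate decides membership in
    \<open>S1\<close> and in \<open>S2\<close>.\<close>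
  consider (GG) I1 I2 where "S1 = I1 \<times> ?W" "S2 = I2 \<times> ?W"
    | (HH) J1 J2 where "S1 = ?V \<times> J1" "S2 = ?V \<times> J2"
    | (GH) I1 J2 where "independent_set G I1" "independent_set H J2" "S1 = I1 \<times> ?W" "S2 = ?V \<times> J2"
    | (HG) J1 I2 where "independent_set G I2" "independent_set H J1" "S1 = ?V \<times> J1" "S2 = I2 \<times> ?W"
    using normal max12 unfolding MIS_normal_def by metis
  then show False
  proof cases
    case GG
    \<comment> \<open>If the whole fibre over \<open>x\<close> avoided \<open>N\<close>, then
      \<open>S2\<close> would meet it in \<open>J\<close>, neither empty nor full. So the fibre
      meets \<open>N\<close>, where \<open>S1\<close> and \<open>S2\<close> agree; being constant
      along the fibre, they agree at \<open>(x, y)\<close> too.\<close>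
    obtain v where v: "v \<in> ?W" "(x, v) \<in> N"
      using out(2)[OF xy(1), of j] out(2)[OF xy(1), of j'] j GG by auto
    then show False using inn[OF v(2)] diff GG xy by auto
  next
    case HH
    \<comment> \<open>The same argument along the line with second coordinate \<open>y\<close>,
      using that \<open>S1\<close> follows \<open>I\<close> outside \<open>N\<close>.\<close>
    obtain u where u: "u \<in> ?V" "(u, y) \<in> N"
      using out(1)[OF _ xy(2), of i] out(1)[OF _ xy(2), of i'] i HH xy by auto
    then show False using inn[OF u(2)] diff HH xy by auto
  next
    case GH
    obtain u where u: "u \<in> ?V" "u \<notin> I1"
      using independent_set_psubset[OF G(1,2) GH(1)] by blast
    \<comment> \<open>As \<open>(a, b)\<close> lies in \<open>S2\<close>, all of V(G) \<times> {b}
      does. At a vertex \<open>u\<close> outside \<open>I1\<close> the two sets differ, so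
      \<open>(u, b)\<close> is outside \<open>N\<close>, where membership in \<open>S2\<close> means
      \<open>b \<in> J\<close>.\<close>
    have "b \<in> J2" using ab GH inn B_N by (metis mem_Sigma_iff subsetD)
    then have "(u, b) \<notin> N" "(u, b) \<in> S2"
      using inn[of u b] u \<open>b \<in> ?W\<close> GH by auto
    then show False using out(2)[OF u(1) \<open>b \<in> ?W\<close>] J(2) by simp
  next
    case HG
    have "J1 \<noteq> {}" using X2 maximum_independent_setD(2)[OF max12(1)] HG by auto
    moreover have J1: "J1 \<subset> ?W" by (rule independent_set_psubset[OF H(1,2) HG(2)])
    ultimately obtain w w' where w: "w \<in> ?W" "w \<in> J1" "w' \<in> ?W" "w' \<notin> J1" by blast
    \<comment> \<open>Choosing \<open>v\<close> in \<open>J1\<close> exactly when \<open>u\<close>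
      is not in \<open>I2\<close> makes \<open>S1\<close> and \<open>S2\<close> differ at
      \<open>(u, v)\<close>. This point is thus outside \<open>N\<close>, where \<open>S1\<close>
      follows \<open>I\<close>. Hence \<open>I\<close> and \<open>I2\<close> are complementary
      independent sets, a bipartition of \<open>G\<close>.\<close>
    have "u \<in> I \<longleftrightarrow> u \<notin> I2" if u: "u \<in> ?V" for u
    proof -
      obtain v where v: "v \<in> ?W" "v \<in> J1 \<longleftrightarrow> u \<notin> I2" using w by blast
      then have "(u, v) \<notin> N" using inn[of u v] u HG by auto
      then show ?thesis using out(1)[OF u v(1)] u v HG by auto
    qed
    then have part: "I \<union> I2 = ?V" "I \<inter> I2 = {}"
      using ID(3) HG(1) by (auto simp: independent_set_def)
    have "(u, v) \<in> I \<times> I2 \<union> I2 \<times> I" if uv: "(u, v) \<in> parcs G" for u v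
    proof -
      have "u \<in> I \<union> I2" "v \<in> I \<union> I2"
        using pair_graph_arcs(3,4)[OF G(1) uv] part(1) by simp_all
      moreover have "\<not> (u \<in> I \<and> v \<in> I)" "\<not> (u \<in> I2 \<and> v \<in> I2)"
        using uv ID(1) HG(1) by (auto simp: independent_set_def)
      ultimately show ?thesis by blast
    qed
    then have "parcs G \<subseteq> I \<times> I2 \<union> I2 \<times> I" by auto
    then show False using G(2) part unfolding bipartite_def by blast
  qed
qed

theorem theorem2p6:
  fixes G :: "'a pair_pre_digraph" and H :: "'b pair_pre_digraph"
  assumes "pair_graph G" and "pair_graph H"
    and "\<not> bipartite G" and "\<not> bipartite H"
    and "vertex_transitive G" and "vertex_transitive H"
    and "real (independence_number H) / real (card (pverts H)) =
         real (independence_number G) / real (card (pverts G))"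
    and "MIS_normal G H"
  shows "IS_primitive G \<and> IS_primitive H \<and> IS_primitive (direct_product G H)"
proof -
  note finG = pair_graph_arcs(1)[OF assms(1)] and finH = pair_graph_arcs(1)[OF assms(2)]
  \<comment> \<open>Nonzero denominators, so that the equation of ratios can be
    cross-multiplied.\<close>
  have "pverts G \<noteq> {}" "pverts H \<noteq> {}"
    using independent_set_psubset[OF assms(1,3), of "{}"] independent_set_psubset[OF assms(2,4), of "{}"]
    by (auto simp: independent_set_def)
  then have "real (independence_number H * card (pverts G)) =
      real (independence_number G * card (pverts H))"
    using assms(7) finG finH by (simp add: field_simps)
  then have ratio: "independence_number H * card (pverts G) = independence_number G * card (pverts H)"
    by linarith
  have "IS_primitive G"
    by (rule MIS_normal_imp_left_IS_primitive[OF assms(1,3,2,4) ratio assms(8)])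
  moreover have "IS_primitive H"
    by (rule MIS_normal_imp_left_IS_primitive[OF assms(2,4,1,3) ratio[symmetric]
          MIS_normal_commute[OF finG finH assms(8)]])
  moreover have "IS_primitive (direct_product G H)"
    by (rule MIS_normal_imp_product_IS_primitive[OF assms(1,3,5,2,4,6) ratio assms(8)])
  ultimately show ?thesis by blast
qed

end
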